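(* Let $H$ and $G$ be graphs and let $k\geq 1$ be an integer. Suppose $H$ is uniquely $k$-$G$-free colourable, $|V(G)|=m$ and $\delta(G)=\delta$. If a vertex $v$ of $H$ satisfies $\deg_H(v)=(k-1)\delta$ and the colour class of $v$ in the unique $G$-free $k$-colouring contains more than $m$ vertices, then $H\setminus\{v\}$ is also uniquely $k$-$G$-free colourable.
   Context: All graphs are finite, simple and undirected; $\delta(G)$ denotes the minimum degree of $G$. For a graph $G$ on at least 2 vertices, a $G$-free $k$-colouring of a graph $H$ is a map $\pi:V(H)\to\{1,\dots,k\}$ such that for every $i$ the subgraph of $H$ induced by $\pi^{-1}(i)$ contains no subgraph isomorphic to $G$. The $G$-free chromatic number $\chi_G(H)$ is the least $k$ for which a $G$-free $k$-colouring of $H$ exists. $H$ is uniquely $k$-$G$-free colourable if $\chi_G(H)=k$ and every $G$-free $k$-colouring of $H$ produces the same partition of $V(H)$ into colour classes. *)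

theory Defs
  imports "Graph_Theory.Graph_Theory"
begin

text \<open>
  A finite simple undirected graph is a finite, loop-free, symmetric digraph without parallel arcs
  (locale \<^locale>\<open>graph\<close>); the undirected edge \<open>uv\<close> is the pair of arcs from \<open>u\<close> to \<open>v\<close> and from
  \<open>v\<close> to \<open>u\<close>. Hence \<^const>\<open>out_degree\<close> is the usual degree.
\<close>

lemma (in graph) out_degree_eq_card_neighbours: "out_degree G v = card {u. v \<rightarrow>\<^bsub>G\<^esub> u}"
proof -
  have "inj_on (head G) (out_arcs G v)"
    by (rule inj_onI) (auto simp: arc_to_ends_def intro: no_multi_arcs)
  moreover have "head G ` out_arcs G v = {u. v \<rightarrow>\<^bsub>G\<^esub> u}"
    by (auto simp: arcs_ends_conv)
  ultimately show ?thesis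
    unfolding out_degree_def by (metis card_image)
qed

definition min_degree :: "('a, 'b) pre_digraph \<Rightarrow> nat" where
  "min_degree G = Min (out_degree G ` verts G)"

definition contains_copy :: "('c, 'd) pre_digraph \<Rightarrow> ('a, 'b) pre_digraph \<Rightarrow> bool" where
  "contains_copy G H \<longleftrightarrow> (\<exists>S. subgraph S H \<and> digraph_iso G S)"

definition colour_class :: "('a, 'b) pre_digraph \<Rightarrow> ('a \<Rightarrow> nat) \<Rightarrow> nat \<Rightarrow> 'a set" where
  "colour_class H \<pi> i = {u \<in> verts H. \<pi> u = i}"

definition free_colouring ::
    "('c, 'd) pre_digraph \<Rightarrow> nat \<Rightarrow> ('a, 'b) pre_digraph \<Rightarrow> ('a \<Rightarrow> nat) \<Rightarrow> bool" where
  "free_colouring G k H \<pi> \<longleftrightarrow>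
     \<pi> ` verts H \<subseteq> {1..k} \<and> (\<forall>i\<in>{1..k}. \<not> contains_copy G (H \<restriction> colour_class H \<pi> i))"

text \<open>
  The least number below exists whenever \<open>G\<close> has at least two vertices
  (lemma \<open>free_colouring_exists\<close>).
\<close>

definition free_chromatic_number ::
    "('c, 'd) pre_digraph \<Rightarrow> ('a, 'b) pre_digraph \<Rightarrow> nat" where
  "free_chromatic_number G H = (LEAST k. \<exists>\<pi>. free_colouring G k H \<pi>)"

text \<open>Only colours that are used contribute a block, so that the blocks are nonempty.\<close>

definition colour_partition :: "('a, 'b) pre_digraph \<Rightarrow> ('a \<Rightarrow> nat) \<Rightarrow> 'a set set" where
  "colour_partition H \<pi> = colour_class H \<pi> ` (\<pi> ` verts H)"

definition uniquely_free_colourable ::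
    "('c, 'd) pre_digraph \<Rightarrow> nat \<Rightarrow> ('a, 'b) pre_digraph \<Rightarrow> bool" where
  "uniquely_free_colourable G k H \<longleftrightarrow>
     free_chromatic_number G H = k \<and>
     (\<forall>\<pi> \<rho>. free_colouring G k H \<pi> \<longrightarrow> free_colouring G k H \<rho> \<longrightarrow>
        colour_partition H \<pi> = colour_partition H \<rho>)"

lemma contains_copy_card_le:
  assumes "contains_copy G H" "finite (verts H)"
  shows "card (verts G) \<le> card (verts H)"
proof -
  obtain S f where S: "subgraph S H" and f: "pre_digraph.digraph_isomorphism G f" "S = app_iso f G"
    using assms(1) unfolding contains_copy_def digraph_iso_def by blast
  have "card (verts S) = card (verts G)"
    using f by (simp add: pre_digraph.digraph_isomorphism_inj_on_verts card_image)
  moreover have "card (verts S) \<le> card (verts H)"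
    using S assms(2) by (simp add: subgraph_imp_subverts card_mono)
  ultimately show ?thesis by simp
qed

lemma free_colouring_exists:
  assumes "graph H" "2 \<le> card (verts G)"
  shows "\<exists>k \<pi>. free_colouring G k H \<pi>"
proof -
  interpret graph H by fact
  obtain \<pi> where \<pi>: "bij_betw \<pi> (verts H) {1..card (verts H)}"
    using finite_same_card_bij[of "verts H" "{1..card (verts H)}"] by auto
  have "\<not> contains_copy G (H \<restriction> colour_class H \<pi> i)" for i
  proof
    assume *: "contains_copy G (H \<restriction> colour_class H \<pi> i)"
    have fin: "finite (colour_class H \<pi> i)"
      by (simp add: colour_class_def)
    have "card (colour_class H \<pi> i) \<le> 1"
      using \<pi> fin unfolding colour_class_def
      by (subst One_nat_def, subst card_le_Suc0_iff_eq) (auto simp: bij_betw_def inj_on_def)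
    then show False
      using contains_copy_card_le[OF *] fin assms(2) by simp
  qed
  then have "free_colouring G (card (verts H)) H \<pi>"
    using \<pi> by (auto simp: free_colouring_def bij_betw_def)
  then show ?thesis by blast
qed

end

theory Submission
  imports Defs
begin

text \<open>
  The point is that every \<open>G\<close>-free \<open>k\<close>-colouring of \<open>H \<setminus> v\<close> extends to \<open>H\<close>; uniqueness then passes
  from \<open>H\<close> to \<open>H \<setminus> v\<close>. If \<open>v\<close> fits into no class, then it completes a copy of \<open>G\<close> with each of them,
  so it has at least \<open>\<delta>\<close> neighbours in each class and \<open>k\<delta> \<le> (k - 1)\<delta>\<close>. This forces \<open>\<delta> = 0\<close>, so \<open>v\<close>
  is isolated and plays an isolated vertex of \<open>G\<close> in every copy. A class with \<open>m\<close> vertices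
  could replace \<open>v\<close> by one of its own vertices, so all classes of \<open>H \<setminus> v\<close> have fewer than \<open>m\<close> vertices
  and \<open>|V(H)| \<le> k(m - 1) + 1\<close>. On the other hand, in the unique colouring of \<open>H\<close> the class of \<open>v\<close>
  has more than \<open>m\<close> vertices, and every other class has at least \<open>m - 1\<close>, as otherwise \<open>v\<close> could be
  moved into it; hence \<open>|V(H)| > k(m - 1) + 1\<close>, a contradiction.
\<close>

section \<open>Copies of \<open>G\<close> as injective adjacency-preserving vertex maps\<close>

lemma contains_copy_iff:
  assumes "nomulti_digraph G" "wf_digraph H"
  shows "contains_copy G H \<longleftrightarrow>
    (\<exists>f. inj_on f (verts G) \<and> f ` verts G \<subseteq> verts H \<and>
      (\<forall>u w. u \<rightarrow>\<^bsub>G\<^esub> w \<longrightarrow> f u \<rightarrow>\<^bsub>H\<^esub> f w))" (is "?L \<longleftrightarrow> ?R")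
proof
  interpret G: nomulti_digraph G by fact
  assume ?L
  then obtain S h where S: "subgraph S H" and h: "G.digraph_isomorphism h" "S = app_iso h G"
    unfolding contains_copy_def digraph_iso_def by blast
  have "iso_verts h u \<rightarrow>\<^bsub>H\<^esub> iso_verts h w" if "u \<rightarrow>\<^bsub>G\<^esub> w" for u w
  proof -
    obtain a where a: "a \<in> arcs G" "tail G a = u" "head G a = w"
      using \<open>u \<rightarrow>\<^bsub>G\<^esub> w\<close> by (auto simp: arcs_ends_def arc_to_ends_def)
    have "iso_arcs h a \<in> arcs H" "tail H = iso_tail h" "head H = iso_head h"
      using S a h(2) by (auto simp: subgraph_def compatible_def)
    moreover have "iso_tail h (iso_arcs h a) = iso_verts h u" "iso_head h (iso_arcs h a) = iso_verts h w"
      using h(1) a by (auto simp: G.iso_verts_tail G.iso_verts_head)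
    ultimately show ?thesis
      by (auto simp: arcs_ends_def arc_to_ends_def intro!: rev_image_eqI)
  qed
  moreover have "inj_on (iso_verts h) (verts G)" "iso_verts h ` verts G \<subseteq> verts H"
    using h S by (auto simp: G.digraph_isomorphism_def subgraph_def)
  ultimately show ?R by blast
next
  interpret G: nomulti_digraph G by fact
  interpret H: wf_digraph H by fact
  assume ?R
  then obtain f where inj: "inj_on f (verts G)" and sub: "f ` verts G \<subseteq> verts H"
    and f: "\<And>u w. u \<rightarrow>\<^bsub>G\<^esub> w \<Longrightarrow> f u \<rightarrow>\<^bsub>H\<^esub> f w"
    by blast
  have "\<exists>b. b \<in> arcs H \<and> tail H b = f (tail G a) \<and> head H b = f (head G a)" if "a \<in> arcs G" for a
    using f[OF G.in_arcs_imp_in_arcs_ends[OF that]]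
    by (auto simp: arcs_ends_def arc_to_ends_def)
  then obtain g where g: "\<And>a. a \<in> arcs G \<Longrightarrow>
      g a \<in> arcs H \<and> tail H (g a) = f (tail G a) \<and> head H (g a) = f (head G a)"
    by metis
  \<comment> \<open>Arcs with a common image have equal ends because \<open>f\<close> is injective,
    and \<open>G\<close> has no parallel arcs.\<close>
  have "inj_on g (arcs G)"
  proof (rule inj_onI)
    fix a b assume ab: "a \<in> arcs G" "b \<in> arcs G" "g a = g b"
    then have "f (tail G a) = f (tail G b)" "f (head G a) = f (head G b)"
      using g by metis+
    then have "arc_to_ends G a = arc_to_ends G b"
      using inj ab by (auto simp: arc_to_ends_def dest: inj_onD)
    then show "a = b" using ab by (blast intro: G.no_multi_arcs)
  qed
  \<comment> \<open>The end maps of \<open>H\<close> are reused, so that the image of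
    \<open>G\<close> is compatible with \<open>H\<close>, as \<open>subgraph\<close>
    demands.\<close>
  define h where "h = \<lparr>iso_verts = f, iso_arcs = g, iso_head = head H, iso_tail = tail H\<rparr>"
  have iso: "G.digraph_isomorphism h"
    using inj \<open>inj_on g (arcs G)\<close> g G.wf_digraph_axioms by (auto simp: h_def G.digraph_isomorphism_def)
  moreover have "subgraph (app_iso h G) H"
    using sub g G.wf_digraphI_app_iso[OF iso] H.wf_digraph_axioms
    by (auto simp: subgraph_def compatible_def h_def)
  ultimately show ?L
    unfolding contains_copy_def digraph_iso_def by blast
qed

text \<open>Both ends of an edge of \<open>G\<close> are vertices of \<open>G\<close>, so their
  images lie in \<open>A\<close> anyway and adjacency can be tested in \<open>H\<close>. Only the
  range condition then depends on \<open>A\<close>, which makes exchange arguments easy.\<close>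

lemma contains_copy_induce_iff:
  assumes "nomulti_digraph G" "wf_digraph H"
  shows "contains_copy G (H \<restriction> A) \<longleftrightarrow>
    (\<exists>f. inj_on f (verts G) \<and> f ` verts G \<subseteq> A \<and>
      (\<forall>u w. u \<rightarrow>\<^bsub>G\<^esub> w \<longrightarrow> f u \<rightarrow>\<^bsub>H\<^esub> f w))"
proof -
  interpret G: nomulti_digraph G by fact
  interpret H: wf_digraph H by fact
  have "x \<rightarrow>\<^bsub>H \<restriction> A\<^esub> y \<longleftrightarrow> x \<in> A \<and> y \<in> A \<and> x \<rightarrow>\<^bsub>H\<^esub> y" for x y
    by (auto simp: arcs_ends_def arc_to_ends_def image_iff)
  moreover have "f u \<in> A" "f w \<in> A" if "f ` verts G \<subseteq> A" "u \<rightarrow>\<^bsub>G\<^esub> w" for f u w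
    using that G.adj_in_verts by blast+
  ultimately show ?thesis
    unfolding contains_copy_iff[OF assms(1) H.wellformed_induce_subgraph] induce_subgraph_verts
    by (intro ex_cong1 conj_cong refl) simp
qed

lemma contains_copy_mono:
  assumes "nomulti_digraph G" "wf_digraph H" "A \<subseteq> B" "contains_copy G (H \<restriction> A)"
  shows "contains_copy G (H \<restriction> B)"
  using assms(3,4) unfolding contains_copy_induce_iff[OF assms(1,2)] by blast

lemma not_contains_copy_subsingleton:
  assumes "2 \<le> card (verts G)" "finite A" "card A \<le> 1"
  shows "\<not> contains_copy G (H \<restriction> A)"
  using contains_copy_card_le[of G "H \<restriction> A"] assms by auto

section \<open>Copies completed by a single vertex\<close>

lemma min_degree_le_neighbours:
  assumes "graph G" "graph H" "finite A"
    and "contains_copy G (H \<restriction> insert v A)" "\<not> contains_copy G (H \<restriction> A)"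
  shows "min_degree G \<le> card {u \<in> A. v \<rightarrow>\<^bsub>H\<^esub> u}"
proof -
  interpret G: graph G by fact
  interpret H: graph H by fact
  note iff = contains_copy_induce_iff[OF G.nomulti_digraph_axioms H.wf_digraph_axioms]
  obtain f where f: "inj_on f (verts G)" "f ` verts G \<subseteq> insert v A"
      "\<And>u w. u \<rightarrow>\<^bsub>G\<^esub> w \<Longrightarrow> f u \<rightarrow>\<^bsub>H\<^esub> f w"
    using assms(4) unfolding iff by blast
  \<comment> \<open>A map missing \<open>v\<close> would give a copy inside \<open>A\<close>. The
    neighbours of \<open>x\<close>, at least \<open>min_degree G\<close> many, go injectively to
    neighbours of \<open>v\<close> in \<open>A\<close>.\<close>
  obtain x where x: "x \<in> verts G" "f x = v"
    using assms(5) f unfolding iff by blast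
  have "min_degree G \<le> out_degree G x"
    unfolding min_degree_def using x by (intro Min_le) auto
  also have "\<dots> = card (f ` {w. x \<rightarrow>\<^bsub>G\<^esub> w})"
    unfolding G.out_degree_eq_card_neighbours
    by (intro card_image[symmetric] inj_on_subset[OF f(1)]) auto
  also have "\<dots> \<le> card {u \<in> A. v \<rightarrow>\<^bsub>H\<^esub> u}"
  proof (intro card_mono subsetI)
    fix u assume "u \<in> f ` {w. x \<rightarrow>\<^bsub>G\<^esub> w}"
    then obtain w where w: "x \<rightarrow>\<^bsub>G\<^esub> w" "u = f w" by blast
    then have "w \<noteq> x" "w \<in> verts G" using G.adj_not_same G.adj_in_verts by blast+
    then have "u \<noteq> v" using f(1) x w(2) by (auto dest: inj_onD)
    then show "u \<in> {u \<in> A. v \<rightarrow>\<^bsub>H\<^esub> u}"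
      using f(2) f(3)[OF w(1)] w(2) x \<open>w \<in> verts G\<close> by auto
  qed (use assms(3) in simp)
  finally show ?thesis .
qed

text \<open>An exchange argument: the preimage \<open>x\<close> of the isolated \<open>v\<close> is
  isolated in \<open>G\<close>, and the rest of the copy uses fewer than
  \<open>card (verts G)\<close> vertices. A larger \<open>A\<close> would have a spare vertex
  \<open>y\<close> to replace \<open>v\<close>.\<close>

lemma card_less_of_isolated_completion:
  assumes "graph G" "graph H" "finite A" "{u. v \<rightarrow>\<^bsub>H\<^esub> u} = {}"
    and "contains_copy G (H \<restriction> insert v A)" "\<not> contains_copy G (H \<restriction> A)"
  shows "card A < card (verts G)"
proof (rule ccontr)
  interpret G: graph G by fact
  interpret H: graph H by fact
  note iff = contains_copy_induce_iff[OF G.nomulti_digraph_axioms H.wf_digraph_axioms]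
  assume "\<not> card A < card (verts G)"
  obtain f where f: "inj_on f (verts G)" "f ` verts G \<subseteq> insert v A"
      "\<And>u w. u \<rightarrow>\<^bsub>G\<^esub> w \<Longrightarrow> f u \<rightarrow>\<^bsub>H\<^esub> f w"
    using assms(5) unfolding iff by blast
  obtain x where x: "x \<in> verts G" "f x = v"
    using assms(6) f unfolding iff by blast
  have iso: "\<not> x \<rightarrow>\<^bsub>G\<^esub> w" "\<not> w \<rightarrow>\<^bsub>G\<^esub> x" for w
    using f(3)[of x w] f(3)[of w x] x(2) assms(4) arcs_ends_symmetric[OF H.sym_arcs] by auto
  have "card (f ` (verts G - {x})) < card (verts G)"
    using f(1) x(1) by (metis G.finite_verts card_Diff1_less card_image_le finite_Diff le_less_trans)
  then obtain y where y: "y \<in> A" "y \<notin> f ` (verts G - {x})"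
    using \<open>\<not> card A < card (verts G)\<close>
    by (metis G.finite_verts card_mono finite_Diff finite_imageI le_trans linorder_not_le subsetI)
  have "inj_on (f(x := y)) (verts G)"
    using f(1) y(2) by (auto simp: inj_on_def)
  moreover have "f w \<in> A" if "w \<in> verts G" "w \<noteq> x" for w
    using f(1,2) x that by (auto dest: inj_onD)
  then have "(f(x := y)) ` verts G \<subseteq> A"
    using y(1) by auto
  moreover have "(f(x := y)) u \<rightarrow>\<^bsub>H\<^esub> (f(x := y)) w" if "u \<rightarrow>\<^bsub>G\<^esub> w" for u w
    using iso that f(3) by auto
  ultimately have "contains_copy G (H \<restriction> A)"
    unfolding iff by blast
  then show False using assms(6) by blast
qed

section \<open>Colour classes and deletion of a vertex\<close>

lemma card_filter_eq_sum_colour_class: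
  assumes "finite (verts H)" "\<pi> ` verts H \<subseteq> {1..k}"
  shows "card {u \<in> verts H. P u} = (\<Sum>i = 1..k. card {u \<in> colour_class H \<pi> i. P u})"
proof -
  have "{u \<in> verts H. P u} = (\<Union>i \<in> {1..k}. {u \<in> colour_class H \<pi> i. P u})"
    using assms(2) by (auto simp: colour_class_def)
  also have "card \<dots> = (\<Sum>i = 1..k. card {u \<in> colour_class H \<pi> i. P u})"
    using assms(1) by (intro card_UN_disjoint) (auto simp: colour_class_def)
  finally show ?thesis .
qed

text \<open>Equal partitions may name their colours differently; the block containing
  \<open>v\<close> is the same all the same.\<close>

lemma colour_class_eq_of_colour_partition_eq:
  assumes "colour_partition H \<pi> = colour_partition H \<rho>" "v \<in> verts H"
  shows "colour_class H \<pi> (\<pi> v) = colour_class H \<rho> (\<rho> v)"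
proof -
  have "colour_class H \<pi> (\<pi> v) \<in> colour_partition H \<rho>"
    unfolding assms(1)[symmetric] using assms(2) by (auto simp: colour_partition_def)
  then obtain u where u: "colour_class H \<pi> (\<pi> v) = colour_class H \<rho> (\<rho> u)"
    by (auto simp: colour_partition_def)
  moreover have "v \<in> colour_class H \<pi> (\<pi> v)"
    using assms(2) by (simp add: colour_class_def)
  ultimately show ?thesis by (simp add: colour_class_def)
qed

lemma colour_class_del_vert:
  "colour_class (pre_digraph.del_vert H v) \<pi> i = colour_class H \<pi> i - {v}"
  by (auto simp: colour_class_def pre_digraph.verts_del_vert)

text \<open>The partition after deletion depends only on the partition before it. A block
  \<open>{v}\<close> becomes empty and is dropped.\<close>

lemma colour_partition_del_vert:
  "colour_partition (pre_digraph.del_vert H v) \<pi> = (\<lambda>B. B - {v}) ` colour_partition H \<pi> - {{}}"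
  (is "?L = ?R")
proof (intro equalityI subsetI)
  fix B assume "B \<in> ?L"
  then show "B \<in> ?R"
    unfolding colour_partition_def colour_class_del_vert pre_digraph.verts_del_vert
    by (auto simp: colour_class_def)
next
  fix B assume "B \<in> ?R"
  \<comment> \<open>The representative \<open>u\<close> may be \<open>v\<close> itself; any
    \<open>w\<close> in the nonempty \<open>B\<close> survives the deletion.\<close>
  then obtain u w where "B = colour_class H \<pi> (\<pi> u) - {v}" "w \<in> B"
    by (auto simp: colour_partition_def)
  then have "w \<in> verts H - {v}" "B = colour_class H \<pi> (\<pi> w) - {v}"
    by (auto simp: colour_class_def)
  then show "B \<in> ?L"
    unfolding colour_partition_def colour_class_del_vert pre_digraph.verts_del_vert by blast
qed

lemma free_colouring_del_vert_iff:
  "free_colouring G k (pre_digraph.del_vert H v) \<pi> \<longleftrightarrow>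
    \<pi> ` (verts H - {v}) \<subseteq> {1..k} \<and>
    (\<forall>i\<in>{1..k}. \<not> contains_copy G (H \<restriction> (colour_class H \<pi> i - {v})))"
proof -
  have "pre_digraph.del_vert H v \<restriction> (A - {v}) = H \<restriction> (A - {v})" for A
    by (auto simp: induce_subgraph_def pre_digraph.del_vert_simps)
  then show ?thesis
    by (simp add: free_colouring_def colour_class_del_vert pre_digraph.verts_del_vert)
qed

lemma free_colouring_del_vert:
  assumes "nomulti_digraph G" "wf_digraph H" "free_colouring G k H \<pi>"
  shows "free_colouring G k (pre_digraph.del_vert H v) \<pi>"
  unfolding free_colouring_del_vert_iff
  using assms(3) contains_copy_mono[OF assms(1,2) Diff_subset]
  unfolding free_colouring_def by blast

text \<open>As a total function, \<open>\<rho>\<close> already gives \<open>v\<close> some colour;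
  hence \<open>v\<close> is removed from its class before it joins class \<open>j\<close>.\<close>

lemma free_colouring_fun_upd:
  assumes "free_colouring G k (pre_digraph.del_vert H v) \<rho>" "v \<in> verts H" "j \<in> {1..k}"
    and "\<not> contains_copy G (H \<restriction> insert v (colour_class H \<rho> j - {v}))"
  shows "free_colouring G k H (\<rho>(v := j))"
proof -
  have class_upd: "colour_class H (\<rho>(v := j)) i =
      (if i = j then insert v (colour_class H \<rho> i - {v}) else colour_class H \<rho> i - {v})" for i
    using assms(2) by (auto simp: colour_class_def)
  have "\<rho> ` (verts H - {v}) \<subseteq> {1..k}"
      "\<forall>i\<in>{1..k}. \<not> contains_copy G (H \<restriction> (colour_class H \<rho> i - {v}))"
    using assms(1) unfolding free_colouring_del_vert_iff by blast+
  then show ?thesis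
    unfolding free_colouring_def class_upd using assms(3,4) by auto
qed

section \<open>Extending colourings over the deleted vertex\<close>

theorem theorem10:
  fixes H :: "('a, 'b) pre_digraph" and G :: "('c, 'd) pre_digraph"
    and k m \<delta> :: nat and v :: 'a and \<pi> :: "'a \<Rightarrow> nat"
  assumes "graph H" and "graph G"
    and "card (verts G) = m" and "2 \<le> m"
    and "min_degree G = \<delta>"
    and "1 \<le> k"
    and "uniquely_free_colourable G k H"
    and "v \<in> verts H"
    and "out_degree H v = (k - 1) * \<delta>"
    and "free_colouring G k H \<pi>"
    and "m < card (colour_class H \<pi> (\<pi> v))"
  shows "uniquely_free_colourable G k (pre_digraph.del_vert H v)"
proof -
  interpret G: graph G by fact
  interpret H: graph H by fact
  note wf = G.nomulti_digraph_axioms H.wf_digraph_axioms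
  let ?H' = "H.del_vert v"
  have fin: "finite (colour_class H \<rho> i)" for \<rho> i
    by (simp add: colour_class_def)
  have unique: "colour_partition H \<rho> = colour_partition H \<pi>" if "free_colouring G k H \<rho>" for \<rho>
    using assms(7,10) that unfolding uniquely_free_colourable_def by blast
  \<comment> \<open>The class of \<open>v\<close> is thus large in every colouring of
    \<open>H\<close>; contradictions below arise by forcing it into \<open>{v}\<close>.\<close>
  have class_v: "colour_class H \<rho> (\<rho> v) = colour_class H \<pi> (\<pi> v)" if "free_colouring G k H \<rho>" for \<rho>
    using colour_class_eq_of_colour_partition_eq[OF unique[OF that] assms(8)] .
  have free_del: "free_colouring G k ?H' \<pi>"
    by (rule free_colouring_del_vert[OF wf assms(10)])

  have chromatic: "free_chromatic_number G ?H' = k"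
    unfolding free_chromatic_number_def
  proof (rule Least_equality)
    show "\<exists>\<rho>. free_colouring G k ?H' \<rho>" using free_del by blast
  next
    fix j assume "\<exists>\<rho>. free_colouring G j ?H' \<rho>"
    then obtain \<rho> where \<rho>: "free_colouring G j ?H' \<rho>" by blast
    show "k \<le> j"
    proof (rule ccontr)
      assume "\<not> k \<le> j"
      \<comment> \<open>With \<open>j < k\<close> colours used on \<open>?H'\<close>, colour
        \<open>k\<close> is free for \<open>v\<close> alone, and a single vertex holds no copy of
        \<open>G\<close>.\<close>
      have unused: "colour_class H \<rho> i - {v} = {}" if "i \<in> {1..k} - {1..j}" for i
        using \<rho> that by (auto simp: free_colouring_del_vert_iff colour_class_def)
      have empty: "\<not> contains_copy G (H \<restriction> {})"
        using not_contains_copy_subsingleton[of G "{}"] assms(3,4) by simp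
      have "free_colouring G k ?H' \<rho>"
        unfolding free_colouring_del_vert_iff
      proof (intro conjI ballI)
        show "\<rho> ` (verts H - {v}) \<subseteq> {1..k}"
          using \<rho> \<open>\<not> k \<le> j\<close> by (force simp: free_colouring_del_vert_iff)
      next
        fix i assume "i \<in> {1..k}"
        then show "\<not> contains_copy G (H \<restriction> (colour_class H \<rho> i - {v}))"
          using \<rho> unused[of i] empty unfolding free_colouring_del_vert_iff by (metis DiffI)
      qed
      moreover have k_empty: "colour_class H \<rho> k - {v} = {}"
        using unused[of k] assms(6) \<open>\<not> k \<le> j\<close> by simp
      moreover have "\<not> contains_copy G (H \<restriction> insert v (colour_class H \<rho> k - {v}))"
        unfolding k_empty using not_contains_copy_subsingleton[of G "{v}"] assms(3,4) by simp
      ultimately have "free_colouring G k H (\<rho>(v := k))"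
        using assms(6,8) by (intro free_colouring_fun_upd) auto
      from class_v[OF this] have "colour_class H \<pi> (\<pi> v) \<subseteq> {v}"
        using k_empty by (fastforce simp: colour_class_def split: if_splits)
      then have "card (colour_class H \<pi> (\<pi> v)) \<le> card {v}"
        by (intro card_mono) auto
      then show False using assms(4,11) by simp
    qed
  qed

  have extend: "\<exists>j. free_colouring G k H (\<rho>(v := j))" if \<rho>: "free_colouring G k ?H' \<rho>" for \<rho>
  proof (rule ccontr)
    assume no_ext: "\<nexists>j. free_colouring G k H (\<rho>(v := j))"
    have img: "\<rho> ` verts ?H' \<subseteq> {1..k}"
      using \<rho> by (simp add: free_colouring_def)
    have fin': "finite (verts ?H')" by (simp add: pre_digraph.verts_del_vert)
    have blocked: "contains_copy G (H \<restriction> insert v (colour_class H \<rho> j - {v}))"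
        "\<not> contains_copy G (H \<restriction> (colour_class H \<rho> j - {v}))" if "j \<in> {1..k}" for j
      using no_ext free_colouring_fun_upd[OF \<rho> assms(8) that] \<rho> that
      by (auto simp: free_colouring_del_vert_iff)
    have "k * \<delta> = (\<Sum>j = 1..k. \<delta>)" by simp
    also have "\<dots> \<le> (\<Sum>j = 1..k. card {u \<in> colour_class ?H' \<rho> j. v \<rightarrow>\<^bsub>H\<^esub> u})"
      unfolding colour_class_del_vert assms(5)[symmetric]
      using blocked fin by (intro sum_mono min_degree_le_neighbours[OF assms(2,1)]) auto
    also have "\<dots> = card {u \<in> verts ?H'. v \<rightarrow>\<^bsub>H\<^esub> u}"
      by (rule card_filter_eq_sum_colour_class[OF fin' img, symmetric])
    also have "\<dots> \<le> card {u. v \<rightarrow>\<^bsub>H\<^esub> u}"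
      by (intro card_mono finite_subset[OF _ H.finite_verts]) (auto simp: H.adj_in_verts)
    also have "\<dots> = (k - 1) * \<delta>"
      using assms(9) H.out_degree_eq_card_neighbours by simp
    \<comment> \<open>Here \<open>1 \<le> k\<close> matters: it makes \<open>k - 1\<close> strictly
      smaller than \<open>k\<close>.\<close>
    finally have "\<delta> = 0"
      using assms(6) by (cases k) auto
    then have "card {u. v \<rightarrow>\<^bsub>H\<^esub> u} = 0"
      using assms(9) H.out_degree_eq_card_neighbours by simp
    moreover have "finite {u. v \<rightarrow>\<^bsub>H\<^esub> u}"
      by (rule finite_subset[OF _ H.finite_verts]) (auto simp: H.adj_in_verts)
    ultimately have isolated: "{u. v \<rightarrow>\<^bsub>H\<^esub> u} = {}" by simp

    have "card (verts ?H') = (\<Sum>j = 1..k. card (colour_class ?H' \<rho> j))"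
      using card_filter_eq_sum_colour_class[OF fin' img, of "\<lambda>_. True"] by simp
    also have "\<dots> \<le> (\<Sum>j = 1..k. m - 1)"
    proof (rule sum_mono)
      fix j assume "j \<in> {1..k}"
      then show "card (colour_class ?H' \<rho> j) \<le> m - 1"
        using card_less_of_isolated_completion[OF assms(2,1) _ isolated blocked] fin assms(3)
        unfolding colour_class_del_vert by fastforce
    qed
    finally have upper: "card (verts ?H') \<le> k * (m - 1)" by simp

    \<comment> \<open>A class of at most \<open>m - 2\<close> vertices has too few for a copy even
      with \<open>v\<close> added. Recolouring \<open>v\<close> by \<open>j\<close> would then give
      it a class that meets its old one only in \<open>v\<close>.\<close>
    have large: "m - 1 \<le> card (colour_class ?H' \<pi> j)" if j: "j \<in> {1..k}" "j \<noteq> \<pi> v" for j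
    proof (rule ccontr)
      assume small: "\<not> m - 1 \<le> card (colour_class ?H' \<pi> j)"
      have "\<not> contains_copy G (H \<restriction> insert v (colour_class H \<pi> j - {v}))"
      proof
        assume "contains_copy G (H \<restriction> insert v (colour_class H \<pi> j - {v}))"
        from contains_copy_card_le[OF this] show False
          using small fin assms(3)
          by (simp add: colour_class_del_vert card_insert_disjoint del: insert_Diff_single)
      qed
      from class_v[OF free_colouring_fun_upd[OF free_del assms(8) j(1) this]]
      have "colour_class H \<pi> (\<pi> v) \<subseteq> {v}"
        using j(2) by (auto simp: colour_class_def split: if_splits)
      then have "card (colour_class H \<pi> (\<pi> v)) \<le> card {v}"
        by (intro card_mono) auto
      then show False using assms(4,11) by simp
    qed
    have img_\<pi>: "\<pi> ` verts ?H' \<subseteq> {1..k}" and "\<pi> v \<in> {1..k}"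
      using assms(8,10) by (auto simp: free_colouring_def pre_digraph.verts_del_vert)
    have "v \<in> colour_class H \<pi> (\<pi> v)"
      using assms(8) by (simp add: colour_class_def)
    \<comment> \<open>Without \<open>v\<close> this class still has at least \<open>m\<close>
      vertices; it supplies the strict summand below.\<close>
    then have "m - 1 < card (colour_class ?H' \<pi> (\<pi> v))"
      using assms(4,11) by (simp add: colour_class_del_vert)
    moreover from this have "m - 1 \<le> card (colour_class ?H' \<pi> j)" if "j \<in> {1..k}" for j
      using large[OF that] by (cases "j = \<pi> v") auto
    ultimately have "(\<Sum>j = 1..k. m - 1) < (\<Sum>j = 1..k. card (colour_class ?H' \<pi> j))"
      using \<open>\<pi> v \<in> {1..k}\<close> by (intro sum_strict_mono_ex1) auto
    also have "\<dots> = card (verts ?H')"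
      using card_filter_eq_sum_colour_class[OF fin' img_\<pi>, of "\<lambda>_. True"] by simp
    finally show False using upper by simp
  qed

  have "colour_partition ?H' \<rho> = colour_partition ?H' \<pi>" if \<rho>: "free_colouring G k ?H' \<rho>" for \<rho>
  proof -
    obtain j where j: "free_colouring G k H (\<rho>(v := j))"
      using extend[OF \<rho>] by blast
    \<comment> \<open>The two colourings agree off \<open>v\<close>, so uniqueness in
      \<open>H\<close> applies to the extension and its partition restricts to
      \<open>?H'\<close>.\<close>
    have "colour_class ?H' \<rho> = colour_class ?H' (\<rho>(v := j))"
      by (auto simp: colour_class_def pre_digraph.verts_del_vert)
    then have "colour_partition ?H' \<rho> = colour_partition ?H' (\<rho>(v := j))"
      unfolding colour_partition_def by (intro image_cong) (auto simp: pre_digraph.verts_del_vert)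
    also have "\<dots> = colour_partition ?H' \<pi>"
      unfolding colour_partition_del_vert unique[OF j] ..
    finally show ?thesis .
  qed
  then show ?thesis
    unfolding uniquely_free_colourable_def using chromatic by metis
qed

end
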